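(* Assume the Continuum Hypothesis. Then there exists a set $X\subseteq\mathbb{R}$ such that $X$ is a $\gamma$-set and a $\sigma$-set, but $X$ is not a hereditary $\gamma$-set; that is, some subset $Y\subseteq X$ is not a $\gamma$-set.
   Context: Every set $X\subseteq\mathbb{R}$ carries the subspace topology, and "open" means relatively open in $X$. An open $\omega$-cover of $X$ is a family $\mathcal{U}$ of open subsets of $X$ such that $X\notin\mathcal{U}$ and every finite subset of $X$ is contained in some member of $\mathcal{U}$. An open $\gamma$-cover of $X$ is an infinite family $\mathcal{U}$ of open subsets of $X$ such that every point $x\in X$ belongs to all but finitely many members of $\mathcal{U}$. A set $X\subseteq\mathbb{R}$ is a $\gamma$-set if it satisfies $\mathsf{S}_1(\Omega,\Gamma)$: for every sequence $(\mathcal{U}_n)_{n\in\mathbb{N}}$ of open $\omega$-covers of $X$ there are $U_n\in\mathcal{U}_n$ ($n\in\mathbb{N}$) such that $\{U_n : n\in\mathbb{N}\}$ is an open $\gamma$-cover of $X$. A set $X\subseteq\mathbb{R}$ is a hereditary $\gamma$-set if every subset of $X$ is a $\gamma$-set. A set $X\subseteq\mathbb{R}$ is a $\sigma$-set if every relatively $G_\delta$ subset of $X$ is relatively $F_\sigma$ in $X$. *)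

theory Defs
  imports "HOL-Analysis.Analysis"
begin

definition Continuum_Hypothesis :: bool where
  "Continuum_Hypothesis \<longleftrightarrow>
     \<not> (\<exists>S::real set. (UNIV::nat set) \<prec> S \<and> S \<prec> (UNIV::real set))"

definition open_omega_covers :: "real set \<Rightarrow> real set set set" where
  "open_omega_covers X =
     {\<U>. (\<forall>U\<in>\<U>. openin (top_of_set X) U) \<and> X \<notin> \<U> \<and>
          (\<forall>F. finite F \<and> F \<subseteq> X \<longrightarrow> (\<exists>U\<in>\<U>. F \<subseteq> U))}"

definition open_gamma_covers :: "real set \<Rightarrow> real set set set" where
  "open_gamma_covers X =
     {\<U>. infinite \<U> \<and> (\<forall>U\<in>\<U>. openin (top_of_set X) U) \<and>
          (\<forall>x\<in>X. finite {U\<in>\<U>. x \<notin> U})}"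

definition S1 :: "'a set set \<Rightarrow> 'a set set \<Rightarrow> bool" where
  "S1 \<A> \<B> \<longleftrightarrow>
     (\<forall>\<U>::nat \<Rightarrow> 'a set. (\<forall>n. \<U> n \<in> \<A>) \<longrightarrow>
        (\<exists>U. (\<forall>n. U n \<in> \<U> n) \<and> range U \<in> \<B>))"

definition gamma_set :: "real set \<Rightarrow> bool" where
  "gamma_set X \<longleftrightarrow> S1 (open_omega_covers X) (open_gamma_covers X)"

definition hereditary_gamma_set :: "real set \<Rightarrow> bool" where
  "hereditary_gamma_set X \<longleftrightarrow> (\<forall>Y. Y \<subseteq> X \<longrightarrow> gamma_set Y)"

definition sigma_set :: "real set \<Rightarrow> bool" where
  "sigma_set X \<longleftrightarrow>
     (\<forall>A. gdelta_in (top_of_set X) A \<longrightarrow> fsigma_in (top_of_set X) A)"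

end

theory Submission
  imports Defs
begin

text \<open>
Doubling destroys heredity. Let \<open>X \<subseteq> [0, 1]\<close> be a \<open>\<gamma>\<close>-set and a \<open>\<sigma>\<close>-set with
continuum many points. The union of \<open>X\<close> and its translate \<open>X + 2\<close> is again both a \<open>\<gamma>\<close>-set and a \<open>\<sigma>\<close>-set, because
an \<open>\<omega>\<close>-cover of the union induces one of \<open>X\<close> (\<open>eventually_selective_double\<close>, \<open>sigma_set_double\<close>). But a subset
\<open>Z\<close> of \<open>X\<close> can be coded by selecting, for every \<open>x\<close> in \<open>X\<close>, either \<open>x\<close> or \<open>x + 2\<close>. If the set selected is
a \<open>\<gamma>\<close>-set, then \<open>Z\<close> is a pointwise limit, on \<open>X\<close>, of a sequence of finite unions of rational intervals.
There are continuum many such sequences and more subsets of \<open>X\<close>, so some selection is not a \<open>\<gamma>\<close>-set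
(\<open>non_gamma_subset_of_double\<close>).

It remains to build \<open>X\<close> from the Continuum Hypothesis. The construction takes place in the Cantor space
and uses a chain of Silver conditions, decreasing modulo finite sets, along a well-order of the reals
with countable initial segments. At each stage countably many points are added, and all later
points must lie in the cube of the current condition. A task given by a sequence of open families is
handled at its stage by two fusions. Either finitely many points destroy the \<open>\<omega>\<close>-covers, or the
condition can be thinned out so that some selection eventually covers all points of its cube
(\<open>gamma_thinning\<close>). The condition can also be refined so that a given \<open>G\<^sub>\<delta>\<close> set has an \<open>F\<^sub>\<sigma>\<close> trace on
its cube (\<open>sigma_refinement\<close>). Only countably many points of \<open>X\<close> lie outside this cube, and countable sets
are harmless for both properties.
\<close>

section \<open>Silver conditions and fusion in the Cantor space\<close>

text \<open>Open sets of the Cantor space are handled through finite prefixes. This keeps the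
fusion arguments below purely combinatorial.\<close>

definition agree :: "nat \<Rightarrow> (nat \<Rightarrow> bool) \<Rightarrow> (nat \<Rightarrow> bool) \<Rightarrow> bool" where
  "agree m x y \<longleftrightarrow> (\<forall>i<m. x i = y i)"

definition cantor_open :: "(nat \<Rightarrow> bool) set \<Rightarrow> bool" where
  "cantor_open S \<longleftrightarrow> (\<forall>x\<in>S. \<exists>m. \<forall>y. agree m x y \<longrightarrow> y \<in> S)"

lemma agree_mono: "agree m x y \<Longrightarrow> k \<le> m \<Longrightarrow> agree k x y"
  by (auto simp: agree_def)

lemma cantor_open_finite_modulus:
  assumes "cantor_open S" "finite A" "A \<subseteq> S"
  obtains m where "\<And>x y. x \<in> A \<Longrightarrow> agree m x y \<Longrightarrow> y \<in> S"
proof -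
  have "\<exists>m. \<forall>x\<in>A. \<forall>y. agree m x y \<longrightarrow> y \<in> S"
    using assms(2,3)
  proof (induction A)
    case empty
    then show ?case by simp
  next
    case (insert a A)
    then obtain m where m: "\<forall>x\<in>A. \<forall>y. agree m x y \<longrightarrow> y \<in> S" by auto
    obtain k where k: "\<forall>y. agree k a y \<longrightarrow> y \<in> S"
      using insert.prems assms(1) by (auto simp: cantor_open_def)
    have "\<forall>x\<in>insert a A. \<forall>y. agree (max m k) x y \<longrightarrow> y \<in> S"
      using m k by (metis agree_mono insert_iff max.cobounded1 max.cobounded2)
    then show ?case by blast
  qed
  then show ?thesis using that by blast
qed

text \<open>A condition \<open>(e, F)\<close> fixes the values \<open>e\<close> at the coordinates outside \<open>F\<close> and leaves the
coordinates in \<open>F\<close> free; the values of \<open>e\<close> on \<open>F\<close> serve only as defaults. With \<open>F\<close> infinite this is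
a Silver condition. The set \<open>cube (e, F)\<close> is closed under finite changes and
is \<open>\<sigma>\<close>-compact, since it is the union of the compact sets \<open>cell e F N\<close>.\<close>

definition cell :: "(nat \<Rightarrow> bool) \<Rightarrow> nat set \<Rightarrow> nat \<Rightarrow> (nat \<Rightarrow> bool) set" where
  "cell e F N = {x. \<forall>i\<ge>N. i \<notin> F \<longrightarrow> x i = e i}"

definition cube :: "(nat \<Rightarrow> bool) \<times> nat set \<Rightarrow> (nat \<Rightarrow> bool) set" where
  "cube p = (\<Union>N. cell (fst p) (snd p) N)"

text \<open>The order is taken modulo finite sets, so that countable chains have lower bounds.\<close>

definition extends :: "(nat \<Rightarrow> bool) \<times> nat set \<Rightarrow> (nat \<Rightarrow> bool) \<times> nat set \<Rightarrow> bool" where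
  "extends q p \<longleftrightarrow> finite (snd q - snd p) \<and> finite {i. i \<notin> snd p \<and> fst q i \<noteq> fst p i}"

lemma extends_refl: "extends p p"
  by (simp add: extends_def)

lemma extends_trans:
  assumes "extends r q" "extends q p"
  shows "extends r p"
proof -
  have "snd r - snd p \<subseteq> (snd r - snd q) \<union> (snd q - snd p)" by auto
  moreover have "{i. i \<notin> snd p \<and> fst r i \<noteq> fst p i} \<subseteq>
      {i. i \<notin> snd q \<and> fst r i \<noteq> fst q i} \<union> {i. i \<notin> snd p \<and> fst q i \<noteq> fst p i} \<union> (snd q - snd p)"
    by auto
  ultimately show ?thesis
    using assms unfolding extends_def by (meson finite_UnI finite_subset)
qed

lemma cube_iff: "x \<in> cube p \<longleftrightarrow> finite {i. i \<notin> snd p \<and> x i \<noteq> fst p i}"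
proof
  assume "x \<in> cube p"
  then obtain N where "x \<in> cell (fst p) (snd p) N" by (auto simp: cube_def)
  then have "{i. i \<notin> snd p \<and> x i \<noteq> fst p i} \<subseteq> {..<N}"
    by (auto simp: cell_def not_le[symmetric])
  then show "finite {i. i \<notin> snd p \<and> x i \<noteq> fst p i}"
    using finite_subset by blast
next
  assume "finite {i. i \<notin> snd p \<and> x i \<noteq> fst p i}"
  then obtain N where "\<forall>i\<in>{i. i \<notin> snd p \<and> x i \<noteq> fst p i}. i < N"
    using finite_nat_set_iff_bounded by meson
  then have "x \<in> cell (fst p) (snd p) N" by (force simp: cell_def)
  then show "x \<in> cube p" by (auto simp: cube_def)
qed

lemma extends_cube_subset: "extends q p \<Longrightarrow> cube q \<subseteq> cube p"
proof
  fix x assume e: "extends q p" and x: "x \<in> cube q"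
  have "{i. i \<notin> snd p \<and> x i \<noteq> fst p i} \<subseteq> 
    {i. i \<notin> snd q \<and> x i \<noteq> fst q i} \<union> {i. i \<notin> snd p \<and> fst q i \<noteq> fst p i} \<union> (snd q - snd p)"
    by auto
  then show "x \<in> cube p"
    using e x unfolding cube_iff extends_def by (meson finite_UnI finite_subset)
qed

lemma uncountable_cube:
  assumes "infinite (snd p)"
  shows "uncountable (cube p)"
proof
  assume c: "countable (cube p)"
  define h :: "nat set \<Rightarrow> nat \<Rightarrow> bool" where
    "h A = (\<lambda>i. if i \<in> snd p then i \<in> A else fst p i)" for A
  have "inj_on h (Pow (snd p))"
  proof (rule inj_onI)
    fix A B assume AB: "A \<in> Pow (snd p)" "B \<in> Pow (snd p)" and "h A = h B"
    have "i \<in> A \<longleftrightarrow> i \<in> B" if "i \<in> snd p" for i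
      using fun_cong[OF \<open>h A = h B\<close>, of i] that by (simp add: h_def)
    then show "A = B" using AB by blast
  qed
  moreover have "h ` Pow (snd p) \<subseteq> cube p"
  proof
    fix x assume "x \<in> h ` Pow (snd p)"
    then have "{i. i \<notin> snd p \<and> x i \<noteq> fst p i} = {}" by (auto simp: h_def)
    then show "x \<in> cube p" unfolding cube_iff by (metis finite.emptyI)
  qed
  ultimately have "countable (Pow (snd p))"
    using c by (meson countable_image_inj_on countable_subset)
  moreover have "uncountable (Pow (snd p))"
  proof
    assume "countable (Pow (snd p))"
    then obtain f :: "nat \<Rightarrow> nat set" where f: "range f = Pow (snd p)"
      using range_from_nat_into[of "Pow (snd p)"] by blast
    obtain g :: "nat \<Rightarrow> nat" where g: "bij_betw g UNIV (snd p)"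
      using assms by (metis countableI_type countable_as_injective_image bij_betw_imageI)
    have "{g n |n. g n \<notin> f n} \<in> range f"
      using g unfolding f by (auto simp: bij_betw_def)
    then obtain n where n: "f n = {g n |n. g n \<notin> f n}" by blast
    have "inj g" using g by (simp add: bij_betw_def)
    have "g n \<in> {g n |n. g n \<notin> f n} \<longleftrightarrow> g n \<notin> f n"
      using \<open>inj g\<close> by (auto dest: injD)
    then show False using n by metis
  qed
  ultimately show False by simp
qed

text \<open>The fusions below cut the natural numbers into consecutive intervals \<open>[b k, b (Suc k))\<close>, define
the values on each interval separately, and leave at most the left end points free.\<close>

lemma strict_mono_block:
  fixes b :: "nat \<Rightarrow> nat"
  assumes "strict_mono b" "b n \<le> i"
  obtains k where "n \<le> k" "b k \<le> i" "i < b (Suc k)"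
proof -
  define j where "j = (LEAST j. i < b j)"
  have "i < b (Suc i)"
    using assms(1) by (meson Suc_le_lessD strict_mono_imp_increasing)
  then have j: "i < b j" unfolding j_def by (rule LeastI)
  then have "b n < b j" using assms(2) by simp
  then have "n < j" using assms(1) by (simp add: strict_mono_less)
  then obtain k where k: "j = Suc k" by (cases j) auto
  have "\<not> i < b k" using not_less_Least[of k "\<lambda>j. i < b j"] k unfolding j_def by simp
  then show ?thesis using that[of k] j k \<open>n < j\<close> by simp
qed

lemma glue_blocks:
  fixes b :: "nat \<Rightarrow> nat" and t :: "nat \<Rightarrow> nat \<Rightarrow> 'a"
  assumes "strict_mono b"
  shows "\<exists>e. (\<forall>k i. b k \<le> i \<longrightarrow> i < b (Suc k) \<longrightarrow> e i = t k i) \<and> (\<forall>i<b 0. e i = d i)"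
proof -
  define e where "e i = (if i < b 0 then d i else t (LEAST k. i < b (Suc k)) i)" for i
  have 1: "e i = t k i" if "b k \<le> i" "i < b (Suc k)" for k i
  proof -
    have "(LEAST k. i < b (Suc k)) = k"
    proof (rule Least_equality)
      show "i < b (Suc k)" by fact
      fix y assume "i < b (Suc y)"
      then have "b k < b (Suc y)" using that by linarith
      then have "k < Suc y" using assms by (simp add: strict_mono_less)
      then show "k \<le> y" by simp
    qed
    moreover have "b 0 \<le> i"
      using that(1) assms by (meson le_trans strict_mono_less_eq zero_le)
    ultimately show ?thesis by (simp add: e_def)
  qed
  then show ?thesis by (intro exI[of _ e]) (simp add: e_def)
qed

lemma increasing_choice:
  fixes R :: "nat \<Rightarrow> nat \<Rightarrow> nat \<Rightarrow> bool"
  assumes "\<And>k c. \<exists>d>c. P d \<and> R k c d"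
  shows "\<exists>b. strict_mono b \<and> (\<forall>k. P (b k)) \<and> (\<forall>k. R k (b k) (b (Suc k)))"
proof -
  have "\<exists>b. \<forall>k. P (b k) \<and> (b k < b (Suc k) \<and> R k (b k) (b (Suc k)))"
  proof (rule dependent_nat_choice)
    show "\<exists>x. P x" using assms by blast
    fix x and k :: nat
    show "\<exists>y. P y \<and> x < y \<and> R k x y" using assms by blast
  qed
  then obtain b where "\<forall>k. P (b k) \<and> (b k < b (Suc k) \<and> R k (b k) (b (Suc k)))" ..
  then show ?thesis by (intro exI[of _ b]) (simp add: strict_mono_Suc_iff)
qed

lemma finite_eventually_fixed: "finite {x :: nat \<Rightarrow> bool. \<forall>i\<ge>n. x i = e i}"
proof -
  have "inj_on (\<lambda>x. {i. i < n \<and> x i}) {x. \<forall>i\<ge>n. x i = e i}"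
  proof (rule inj_onI)
    fix x y assume "x \<in> {x. \<forall>i\<ge>n. x i = e i}" "y \<in> {x. \<forall>i\<ge>n. x i = e i}"
      and s: "{i. i < n \<and> x i} = {i. i < n \<and> y i}"
    then have xy: "\<forall>i\<ge>n. x i = e i" "\<forall>i\<ge>n. y i = e i" by auto
    show "x = y"
    proof
      fix i show "x i = y i"
        using xy s by (cases "i < n") (auto simp: set_eq_iff)
    qed
  qed
  moreover have "(\<lambda>x. {i. i < n \<and> x i}) ` {x. \<forall>i\<ge>n. x i = e i} \<subseteq> Pow {..<n}" by auto
  ultimately show ?thesis
    by (meson finite_Pow_iff finite_imageD finite_lessThan finite_subset)
qed

text \<open>It suffices to thin out the free coordinates. Suppose the free coordinates up to \<open>b\<close> have been chosen.
Only finitely many points agree with the defaults \<open>e\<close> beyond \<open>b\<close>, so a single member of the next cover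
contains all of them. As it is open and contains finitely many such points, it contains every point that agrees
with \<open>e\<close> strictly between \<open>b\<close> and some later free coordinate, and this coordinate is kept as the next one.
A point of the thinner cube agrees with \<open>e\<close> on almost all of these gaps.\<close>

lemma gamma_thinning:
  fixes \<U> :: "nat \<Rightarrow> (nat \<Rightarrow> bool) set set"
  assumes inf: "infinite (snd p)" and "countable C"
    and op: "\<And>k U. U \<in> \<U> k \<Longrightarrow> cantor_open U"
    and om: "\<And>k A. finite A \<Longrightarrow> A \<subseteq> C \<union> cube p \<Longrightarrow> \<exists>U\<in>\<U> k. A \<subseteq> U"
  obtains q U where "infinite (snd q)" "extends q p" "\<And>k. U k \<in> \<U> k"
    "\<And>x. x \<in> C \<union> cube q \<Longrightarrow> \<forall>\<^sub>F k in sequentially. x \<in> U k"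
proof -
  obtain e F where p: "p = (e, F)" by (cases p)
  have F: "infinite F" using inf p by simp
  obtain c :: "nat \<Rightarrow> nat \<Rightarrow> bool" where c: "C \<subseteq> range c"
    using \<open>countable C\<close> by (metis countable_as_injective_image_subset image_mono subset_UNIV)
  define R where "R k b d \<longleftrightarrow> (\<exists>U\<in>\<U> k. (\<forall>j<k. c j \<in> C \<longrightarrow> c j \<in> U) \<and>
      (\<forall>x. (\<forall>i. b < i \<longrightarrow> i < d \<longrightarrow> x i = e i) \<longrightarrow> x \<in> U))" for k b d
  have step: "\<exists>d>b. d \<in> F \<and> R k b d" for k b
  proof -
    define T where "T = {x. \<forall>i\<ge>Suc b. x i = e i}"
    have finT: "finite T" unfolding T_def by (rule finite_eventually_fixed)
    have "T \<subseteq> cube p"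
      by (force simp: T_def cube_def cell_def p)
    then obtain U where U: "U \<in> \<U> k" "(c ` {..<k} \<inter> C) \<union> T \<subseteq> U"
      using om[of "(c ` {..<k} \<inter> C) \<union> T" k] finT by auto
    obtain m where m: "\<And>x y. x \<in> T \<Longrightarrow> agree m x y \<Longrightarrow> y \<in> U"
      using cantor_open_finite_modulus[OF op[OF U(1)] finT] U(2) by (metis Un_subset_iff)
    obtain d where d: "d \<in> F" "max m (Suc b) \<le> d"
      using F unfolding infinite_nat_iff_unbounded_le by blast
    \<comment> \<open>Compare \<open>x\<close> with the point that equals \<open>x\<close> up to \<open>b\<close> and \<open>e\<close> from there on.\<close>
    have "x \<in> U" if x: "\<forall>i. b < i \<longrightarrow> i < d \<longrightarrow> x i = e i" for x
    proof (rule m)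
      show "(\<lambda>i. if i \<le> b then x i else e i) \<in> T" by (auto simp: T_def)
      show "agree m (\<lambda>i. if i \<le> b then x i else e i) x"
        using x d by (auto simp: agree_def)
    qed
    moreover have "\<forall>j<k. c j \<in> C \<longrightarrow> c j \<in> U" using U(2) by auto
    ultimately have "R k b d" using U(1) unfolding R_def by blast
    moreover have "b < d" using d(2) by simp
    ultimately show ?thesis using d(1) by blast
  qed
  obtain b where b: "strict_mono b" "\<And>k. b k \<in> F" "\<And>k. R k (b k) (b (Suc k))"
    using increasing_choice[of "\<lambda>d. d \<in> F" R] step by auto
  obtain U where U: "\<And>k. U k \<in> \<U> k" "\<And>k j. j < k \<Longrightarrow> c j \<in> C \<Longrightarrow> c j \<in> U k"
    "\<And>k x. (\<forall>i. b k < i \<longrightarrow> i < b (Suc k) \<longrightarrow> x i = e i) \<Longrightarrow> x \<in> U k"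
    using b(3) unfolding R_def by metis
  define q where "q = (e, range b)"
  show ?thesis
  proof
    show "infinite (snd q)"
      using b(1) by (simp add: q_def range_inj_infinite strict_mono_imp_inj_on)
    show "extends q p"
      using b(2) by (auto simp: q_def p extends_def image_subset_iff Diff_eq_empty_iff[THEN iffD2])
    show "U k \<in> \<U> k" for k by (rule U)
    fix x assume "x \<in> C \<union> cube q"
    then show "\<forall>\<^sub>F k in sequentially. x \<in> U k"
    proof
      assume "x \<in> C"
      then obtain j where "x = c j" using c by auto
      then show ?thesis
        using U(2)[of j] \<open>x \<in> C\<close> by (auto simp: eventually_sequentially intro!: exI[of _ "Suc j"])
    next
      assume "x \<in> cube q"
      then obtain N where N: "\<And>i. i \<ge> N \<Longrightarrow> i \<notin> range b \<Longrightarrow> x i = e i"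
        by (auto simp: cube_def cell_def q_def)
      have "x \<in> U k" if "k \<ge> N" for k
      proof (rule U(3), intro allI impI)
        fix i assume i: "b k < i" "i < b (Suc k)"
        have "k \<le> b k" using b(1) strict_mono_imp_increasing by blast
        moreover have "i \<notin> range b"
          using i b(1) by (auto simp: strict_mono_less)
        ultimately show "x i = e i" using N i that by simp
      qed
      then show ?thesis by (auto simp: eventually_sequentially)
    qed
  qed
qed

definition block :: "(nat \<Rightarrow> bool) \<Rightarrow> (nat \<Rightarrow> bool) \<Rightarrow> nat \<Rightarrow> nat \<Rightarrow> (nat \<Rightarrow> bool) \<times> nat set \<Rightarrow> (nat \<Rightarrow> bool) set"
  where "block s w b d p = {x. (\<forall>i\<le>b. x i = s i) \<and> (\<forall>i. b < i \<longrightarrow> i < d \<longrightarrow> x i = w i) \<and>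
      (\<forall>i\<ge>d. i \<notin> snd p \<longrightarrow> x i = fst p i)}"

text \<open>One pair is decided at a time: if the current block meets the open set \<open>G\<close>, then following a common
point for long enough puts the whole block inside \<open>G\<close>. Decisions made earlier survive, because
longer blocks are smaller.\<close>

lemma decide_finitely_many:
  assumes "finite Q" and "\<forall>c\<in>Q. cantor_open (snd c)"
  shows "\<exists>w d. d > b \<and> (\<forall>i. i \<notin> snd p \<longrightarrow> w i = fst p i) \<and>
    (\<forall>s G. (s, G) \<in> Q \<longrightarrow> block s w b d p \<subseteq> G \<or> block s w b d p \<inter> G = {})"
  using assms
proof (induction Q)
  case empty
  show ?case by (intro exI[of _ "fst p"] exI[of _ "Suc b"]) auto
next
  case (insert sG Q)
  obtain s G where sG: "sG = (s, G)" by (cases sG)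
  have G: "cantor_open G" using insert.prems sG by auto
  obtain w d where wd: "d > b" "\<And>i. i \<notin> snd p \<Longrightarrow> w i = fst p i"
    "\<And>s G. (s, G) \<in> Q \<Longrightarrow> block s w b d p \<subseteq> G \<or> block s w b d p \<inter> G = {}"
    using insert.IH insert.prems by (metis insertCI)
  show ?case
  proof (cases "block s w b d p \<inter> G = {}")
    case True
    have "block s1 w b d p \<subseteq> G1 \<or> block s1 w b d p \<inter> G1 = {}" if "(s1, G1) \<in> insert sG Q" for s1 G1
    proof (cases "(s1, G1) = sG")
      case True
      then show ?thesis using \<open>block s w b d p \<inter> G = {}\<close> sG by simp
    next
      case False
      then show ?thesis using wd(3) that by auto
    qed
    then show ?thesis using wd(1,2) by metis
  next
    case False
    then obtain x where x: "x \<in> block s w b d p" "x \<in> G" by auto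
    obtain m where m: "\<And>y. agree m x y \<Longrightarrow> y \<in> G" using G x(2) by (auto simp: cantor_open_def)
    define w' where "w' i = (if i < d then w i else if i \<in> snd p then x i else fst p i)" for i
    define d' where "d' = max d m"
    have d': "d \<le> d'" "m \<le> d'" by (auto simp: d'_def)
    have "y \<in> G" if y: "y \<in> block s w' b d' p" for y
    proof (rule m)
      have "x i = y i" if "i < d'" for i
      proof (cases "i \<le> b")
        case True
        then show ?thesis using x(1) y by (simp add: block_def)
      next
        case F: False
        then have "y i = w' i" using y that by (simp add: block_def)
        then show ?thesis
          using x(1) F by (cases "i < d") (auto simp: block_def w'_def)
      qed
      then show "agree m x y" using d' by (simp add: agree_def)
    qed
    moreover have "block s1 w' b d' p \<subseteq> block s1 w b d p" for s1
    proof
      fix y assume y: "y \<in> block s1 w' b d' p"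
      have "y i = w i" if "b < i" "i < d" for i
        using y that d' by (simp add: block_def w'_def)
      moreover have "y i = fst p i" if "d \<le> i" "i \<notin> snd p" for i
      proof (cases "i < d'")
        case True
        then have "y i = w' i" using y that wd(1) by (simp add: block_def)
        then show ?thesis using that by (simp add: w'_def)
      next
        case False
        then show ?thesis using y that by (simp add: block_def)
      qed
      ultimately show "y \<in> block s1 w b d p" using y by (simp add: block_def)
    qed
    moreover have "w' i = fst p i" if "i \<notin> snd p" for i
      using that wd(2) by (simp add: w'_def)
    moreover have "b < d'" using wd(1) d' by simp
    moreover have "block s1 w' b d' p \<subseteq> G1 \<or> block s1 w' b d' p \<inter> G1 = {}"
      if "(s1, G1) \<in> insert sG Q" for s1 G1
    proof (cases "(s1, G1) = sG")
      case True
      then show ?thesis using \<open>\<And>y. y \<in> block s w' b d' p \<Longrightarrow> y \<in> G\<close> sG by auto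
    next
      case False
      then have "block s1 w b d p \<subseteq> G1 \<or> block s1 w b d p \<inter> G1 = {}" using wd(3) that by auto
      then show ?thesis using \<open>\<And>s1. block s1 w' b d' p \<subseteq> block s1 w b d p\<close> by blast
    qed
    ultimately show ?thesis by metis
  qed
qed

text \<open>Each stage of the fusion decides the first few open sets on every block with initial
part up to the current free coordinate. So every single set \<open>G n\<close> becomes relatively clopen in every cell,
and the intersection of the \<open>G n\<close> becomes relatively closed there. As the cube is the union of its
cells, the trace of a \<open>G\<^sub>\<delta>\<close> set on it is an \<open>F\<^sub>\<sigma>\<close> set.\<close>

lemma sigma_refinement:
  fixes G :: "nat \<Rightarrow> (nat \<Rightarrow> bool) set"
  assumes inf: "infinite (snd p)" and op: "\<And>n. cantor_open (G n)"
  obtains q where "infinite (snd q)" "extends q p"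
    "\<And>N. cantor_open (- ((\<Inter>n. G n) \<inter> cell (fst q) (snd q) N))"
proof -
  obtain e F where p: "p = (e, F)" by (cases p)
  have F: "infinite F" using inf p by simp
  define R where "R k b d \<longleftrightarrow> (\<exists>w. (\<forall>i. i \<notin> F \<longrightarrow> w i = e i) \<and>
     (\<forall>s. \<forall>n\<le>k. block s w b d p \<subseteq> G n \<or> block s w b d p \<inter> G n = {}))" for k b d
  have step: "\<exists>d>b. d \<in> F \<and> R k b d" for k b
  proof -
    \<comment> \<open>Only the values of \<open>s\<close> up to \<open>b\<close> matter, so finitely many representatives suffice.\<close>
    define Q where "Q = {s. \<forall>i\<ge>Suc b. s i = False} \<times> G ` {..k}"
    have "finite Q" unfolding Q_def by (intro finite_cartesian_product finite_eventually_fixed) auto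
    moreover have "\<forall>c\<in>Q. cantor_open (snd c)" using op by (auto simp: Q_def)
    ultimately obtain w d where wd: "d > b" "\<And>i. i \<notin> F \<Longrightarrow> w i = e i"
      "\<And>s H. (s, H) \<in> Q \<Longrightarrow> block s w b d p \<subseteq> H \<or> block s w b d p \<inter> H = {}"
      using decide_finitely_many[of Q b p] unfolding p by (metis fst_conv snd_conv)
    obtain d' where d': "d' \<in> F" "d \<le> d'"
      using F unfolding infinite_nat_iff_unbounded_le by blast
    have "block s w b d' p \<subseteq> G n \<or> block s w b d' p \<inter> G n = {}" if "n \<le> k" for s n
    proof -
      define s' where "s' i = (i \<le> b \<and> s i)" for i
      have "(s', G n) \<in> Q" using that by (auto simp: Q_def s'_def)
      moreover have "block s w b d' p \<subseteq> block s' w b d p"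
      proof
        fix y assume y: "y \<in> block s w b d' p"
        have "y i = e i" if "d \<le> i" "i \<notin> F" for i
          using y that wd(1,2) by (cases "i < d'") (auto simp: block_def p)
        then show "y \<in> block s' w b d p" using y d' by (auto simp: block_def s'_def p)
      qed
      ultimately show ?thesis using wd(3) by blast
    qed
    moreover have "b < d'" using wd(1) d' by simp
    ultimately show ?thesis using d' wd(2) unfolding R_def by blast
  qed
  obtain b where b: "strict_mono b" "\<And>k. b k \<in> F" "\<And>k. R k (b k) (b (Suc k))"
    using increasing_choice[of "\<lambda>d. d \<in> F" R] step by auto
  obtain t where t: "\<And>k i. i \<notin> F \<Longrightarrow> t k i = e i"
    "\<And>k n s. n \<le> k \<Longrightarrow> block s (t k) (b k) (b (Suc k)) p \<subseteq> G n \<or>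
        block s (t k) (b k) (b (Suc k)) p \<inter> G n = {}"
    using b(3) unfolding R_def by metis
  obtain e' where e': "\<And>k i. b k \<le> i \<Longrightarrow> i < b (Suc k) \<Longrightarrow> e' i = t k i"
    "\<And>i. i < b 0 \<Longrightarrow> e' i = e i"
    using glue_blocks[OF b(1), of t e] by auto
  have e'_e: "e' i = e i" if "i \<notin> F" for i
  proof (cases "i < b 0")
    case False
    then obtain k where "b k \<le> i" "i < b (Suc k)"
      using strict_mono_block[OF b(1), of 0 i] by auto
    then show ?thesis using e'(1) t(1) that by metis
  qed (use e' in auto)
  define q where "q = (e', range b)"
  show ?thesis
  proof
    show "infinite (snd q)"
      using b(1) by (simp add: q_def range_inj_infinite strict_mono_imp_inj_on)
    have "range b - F = {}" "{i. i \<notin> F \<and> e' i \<noteq> e i} = {}" using b(2) e'_e by auto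
    then show "extends q p"
      unfolding q_def p extends_def fst_conv snd_conv by (metis finite.emptyI)
    fix N
    show "cantor_open (- ((\<Inter>n. G n) \<inter> cell (fst q) (snd q) N))"
      unfolding cantor_open_def
    proof (intro ballI)
      fix x assume x: "x \<in> - ((\<Inter>n. G n) \<inter> cell (fst q) (snd q) N)"
      show "\<exists>m. \<forall>y. agree m x y \<longrightarrow> y \<in> - ((\<Inter>n. G n) \<inter> cell (fst q) (snd q) N)"
      proof (cases "x \<in> cell (fst q) (snd q) N")
        case False
        then obtain i where "i \<ge> N" "i \<notin> range b" "x i \<noteq> e' i" by (auto simp: cell_def q_def)
        then show ?thesis
          by (intro exI[of _ "Suc i"]) (auto simp: agree_def cell_def q_def)
      next
        case True
        then obtain n where n: "x \<notin> G n" using x by auto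
        define k where "k = max n N"
        have bk: "N \<le> b k"
          using b(1) by (metis k_def le_trans max.cobounded2 strict_mono_imp_increasing)
        have inbox: "y \<in> block x (t k) (b k) (b (Suc k)) p"
          if y: "y \<in> cell (fst q) (snd q) N" "agree (b (Suc k)) x y" for y
        proof -
          have "b k < b (Suc k)" using b(1) by (simp add: strict_mono_less)
          then have "y i = x i" if "i \<le> b k" for i using y(2) that by (simp add: agree_def)
          moreover have "y i = t k i" if "b k < i" "i < b (Suc k)" for i
          proof -
            have "i \<notin> range b" using that b(1) by (auto simp: strict_mono_less)
            then have "y i = e' i" using y(1) that bk by (simp add: cell_def q_def)
            then show ?thesis using e'(1) that by simp
          qed
          moreover have "y i = e i" if "i \<ge> b (Suc k)" "i \<notin> F" for i
          proof -
            have "i \<notin> range b" using that b(2) by auto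
            then have "y i = e' i" using y(1) that bk \<open>b k < b (Suc k)\<close> by (simp add: cell_def q_def)
            then show ?thesis using e'_e that by simp
          qed
          ultimately show ?thesis by (simp add: block_def p)
        qed
        have "x \<in> block x (t k) (b k) (b (Suc k)) p"
          using inbox[OF True] by (simp add: agree_def)
        then have "block x (t k) (b k) (b (Suc k)) p \<inter> G n = {}"
          using t(2)[of n k x] n by (auto simp: k_def)
        then show ?thesis using inbox by (intro exI[of _ "b (Suc k)"]) blast
      qed
    qed
  qed
qed

text \<open>Diagonalisation: follow \<open>f k\<close> on a later and later interval, beginning only where \<open>f k\<close> already
extends every earlier condition without exceptions, and keep one free coordinate per interval.\<close>

lemma lower_bound_sequence:
  assumes inf: "\<And>n. infinite (snd (f n))" and ext: "\<And>n. extends (f (Suc n)) (f n)"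
  obtains q where "infinite (snd q)" "\<And>n. extends q (f n)"
proof -
  have ext': "extends (f m) (f n)" if "n \<le> m" for n m
    using that by (induction m rule: dec_induct) (auto intro: extends_refl extends_trans ext)
  define P where "P k c d \<longleftrightarrow> (\<forall>n\<le>k. d \<in> snd (f n) \<and>
     (\<forall>i\<ge>d. i \<notin> snd (f n) \<longrightarrow> fst (f k) i = fst (f n) i))" for k c d :: nat
  have step: "\<exists>d>c. P k c d" for k c
  proof -
    define A where "A = (\<Union>n\<le>k. (snd (f k) - snd (f n)) \<union>
       {i. i \<notin> snd (f n) \<and> fst (f k) i \<noteq> fst (f n) i})"
    have "finite A" using ext' by (auto simp: A_def extends_def)
    then obtain a where a: "\<forall>i\<in>A. i < a" using finite_nat_set_iff_bounded by meson
    obtain d where d: "d \<in> snd (f k)" "d \<ge> max a (Suc c)"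
      using inf unfolding infinite_nat_iff_unbounded_le by blast
    have nA: "i \<notin> A" if "i \<ge> d" for i using a that d(2) by force
    have "P k c d"
      unfolding P_def
    proof (intro allI impI conjI)
      fix n assume "n \<le> k"
      then show "d \<in> snd (f n)" using nA[of d] d(1) by (auto simp: A_def)
      fix i assume "d \<le> i" "i \<notin> snd (f n)"
      then show "fst (f k) i = fst (f n) i" using nA[of i] \<open>n \<le> k\<close> by (auto simp: A_def)
    qed
    then show ?thesis using d(2) by (intro exI[of _ d]) auto
  qed
  obtain b where b: "strict_mono b" "\<And>k. P k (b k) (b (Suc k))"
    using increasing_choice[of "\<lambda>_. True" P] step by auto
  \<comment> \<open>The choice of \<open>b (Suc k)\<close> controls \<open>f k\<close> from there on, hence the shift of the index by one.\<close>
  obtain e where e: "\<And>k i. b k \<le> i \<Longrightarrow> i < b (Suc k) \<Longrightarrow> e i = fst (f (k - 1)) i"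
    using glue_blocks[OF b(1), of "\<lambda>k i. fst (f (k - 1)) i" "\<lambda>_. True"]
    by auto
  define q where "q = (e, range (\<lambda>k. b (Suc k)))"
  show ?thesis
  proof
    have "inj (\<lambda>k. b (Suc k))" using b(1) by (auto intro!: injI simp: strict_mono_eq)
    then show "infinite (snd q)" by (simp add: q_def range_inj_infinite)
    fix n
    have "snd q - snd (f n) \<subseteq> (\<lambda>k. b (Suc k)) ` {..<n}"
    proof
      fix i assume "i \<in> snd q - snd (f n)"
      then obtain k where k: "i = b (Suc k)" "i \<notin> snd (f n)" by (auto simp: q_def)
      then have "k < n" using b(2)[of k] unfolding P_def by (metis not_le)
      then show "i \<in> (\<lambda>k. b (Suc k)) ` {..<n}" using k by auto
    qed
    moreover have "{i. i \<notin> snd (f n) \<and> fst q i \<noteq> fst (f n) i} \<subseteq> {..<b (Suc n)}"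
    proof (rule subsetI, rule ccontr)
      fix i assume i: "i \<in> {i. i \<notin> snd (f n) \<and> fst q i \<noteq> fst (f n) i}" "i \<notin> {..<b (Suc n)}"
      then obtain k where k: "k \<ge> Suc n" "b k \<le> i" "i < b (Suc k)"
        using strict_mono_block[OF b(1), of "Suc n" i] by auto
      then obtain l where l: "k = Suc l" by (cases k) auto
      then have "e i = fst (f l) i" using e[of k i] k by simp
      also have "\<dots> = fst (f n) i" using b(2)[of l] k l i unfolding P_def by auto
      finally show False using i by (simp add: q_def)
    qed
    ultimately show "extends q (f n)"
      unfolding extends_def by (meson finite_imageI finite_lessThan finite_subset)
  qed
qed

lemma lower_bound_countable_chain:
  assumes "countable \<C>" and inf: "\<And>p. p \<in> \<C> \<Longrightarrow> infinite (snd p)"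
    and chain: "\<And>p q. p \<in> \<C> \<Longrightarrow> q \<in> \<C> \<Longrightarrow> extends p q \<or> extends q p"
  obtains q where "infinite (snd q)" "\<And>p. p \<in> \<C> \<Longrightarrow> extends q p"
proof (cases "\<C> = {}")
  case True
  then show ?thesis using that[of "(\<lambda>_. False, UNIV)"] by simp
next
  case False
  define c where "c = from_nat_into \<C>"
  have c: "c n \<in> \<C>" for n by (simp add: c_def False from_nat_into)
  have rc: "range c = \<C>" by (simp add: c_def False assms(1) range_from_nat_into)
  have "\<exists>f. \<forall>n. (f n \<in> \<C> \<and> extends (f n) (c n)) \<and> extends (f (Suc n)) (f n)"
  proof (rule dependent_nat_choice)
    show "\<exists>x. x \<in> \<C> \<and> extends x (c 0)" using c extends_refl by blast
    fix x n assume "x \<in> \<C> \<and> extends x (c n)"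
    then show "\<exists>y. (y \<in> \<C> \<and> extends y (c (Suc n))) \<and> extends y x"
      using chain[of x "c (Suc n)"] c extends_refl by blast
  qed
  then obtain f where f: "\<And>n. f n \<in> \<C>" "\<And>n. extends (f n) (c n)" "\<And>n. extends (f (Suc n)) (f n)"
    by blast
  obtain q where "infinite (snd q)" "\<And>n. extends q (f n)"
    using lower_bound_sequence[of f] f inf by metis
  moreover have "extends q p" if "p \<in> \<C>" for p
  proof -
    obtain n where "p = c n" using rc \<open>p \<in> \<C>\<close> by blast
    then show ?thesis using f(2) \<open>\<And>n. extends q (f n)\<close> extends_trans by blast
  qed
  ultimately show ?thesis using that by blast
qed

section \<open>Recursion of length continuum\<close>

lemma CH_well_order:
  assumes "Continuum_Hypothesis"
  obtains r :: "real rel" where "wf r" "total r" "\<And>a. countable {b. (b, a) \<in> r}"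
proof -
  define W where "W = card_of (UNIV :: real set)"
  have W: "Card_order W" "Field W = UNIV" "Well_order W"
    unfolding W_def by (rule card_of_Card_order Field_card_of card_of_Well_order)+
  define r where "r = W - Id"
  have lin: "linear_order_on UNIV W" and "wf r"
    using W by (simp_all add: well_order_on_def r_def)
  have "total r" using lin by (simp add: linear_order_on_def r_def)
  have "countable {b. (b, a) \<in> r}" for a
  proof (rule ccontr)
    assume unc: "uncountable {b. (b, a) \<in> r}"
    define S where "S = {b. (b, a) \<in> r}"
    have "S = underS W a" by (auto simp: S_def r_def underS_def)
    moreover have "(card_of (underS W a), W) \<in> ordLess"
      using W(1,2) by (intro card_of_underS) auto
    ultimately have "(card_of S, card_of (UNIV :: real set)) \<in> ordLess" by (simp add: W_def)
    then have "(card_of (UNIV :: real set), card_of S) \<notin> ordLeq" using not_ordLess_ordLeq by blast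
    then have "\<not> (UNIV :: real set) \<lesssim> S"
      by (simp add: lepoll_def card_of_ordLeq)
    moreover have "S \<lesssim> (UNIV :: real set)" by (simp add: subset_imp_lepoll)
    ultimately have 1: "S \<prec> (UNIV :: real set)"
      unfolding lesspoll_def using eqpoll_imp_lepoll eqpoll_sym by blast
    have "infinite S" using unc countable_finite S_def by blast
    then have "(UNIV :: nat set) \<lesssim> S" by (simp add: infinite_le_lepoll)
    moreover have "\<not> S \<lesssim> (UNIV :: nat set)"
      using unc countable_lepoll[of "UNIV :: nat set" S] by (auto simp: S_def)
    ultimately have "(UNIV :: nat set) \<prec> S"
      unfolding lesspoll_def using eqpoll_imp_lepoll eqpoll_sym by blast
    then show False using 1 assms by (auto simp: Continuum_Hypothesis_def)
  qed
  then show ?thesis using that \<open>wf r\<close> \<open>total r\<close> by blast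
qed

text \<open>There are only continuum many countable tasks, so all of them can be enumerated by the reals.\<close>

lemma surj_real_sets_of_countable:
  obtains T :: "real \<Rightarrow> 'b::countable set" where "surj T"
proof -
  obtain h :: "real \<Rightarrow> nat set" where h: "bij h"
    using nat_sets_eqpoll_reals eqpoll_sym unfolding eqpoll_def by blast
  define T :: "real \<Rightarrow> 'b set" where "T x = {p. to_nat p \<in> h x}" for x
  have "\<exists>x. T x = t" for t
  proof -
    obtain x where "h x = to_nat ` t" using h by (metis bij_pointE)
    then have "T x = t" by (auto simp: T_def)
    then show ?thesis ..
  qed
  then have "surj T" by (metis surjI)
  then show ?thesis using that by blast
qed

text \<open>A set \<open>t\<close> of pairs \<open>(n, c)\<close> codes a sequence of families of basic sets, the \<open>n\<close>-th of which is
\<open>{B c | c. (n, c) \<in> t}\<close>. It codes at the same time the intersection of the unions of these families;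
when \<open>B\<close> enumerates a base, all \<open>G\<^sub>\<delta>\<close> sets arise in this way. Hence one enumeration of codes
serves the \<open>\<gamma>\<close>-property and the \<open>\<sigma>\<close>-property together.\<close>

definition omega_coded :: "('c \<Rightarrow> 'a set) \<Rightarrow> (nat \<times> 'c) set \<Rightarrow> 'a set \<Rightarrow> bool" where
  "omega_coded B t X \<longleftrightarrow> (\<forall>n A. finite A \<longrightarrow> A \<subseteq> X \<longrightarrow> (\<exists>c. (n, c) \<in> t \<and> A \<subseteq> B c))"

definition gamma_coded :: "('c \<Rightarrow> 'a set) \<Rightarrow> (nat \<times> 'c) set \<Rightarrow> 'a set \<Rightarrow> bool" where
  "gamma_coded B t X \<longleftrightarrow> (\<exists>c. (\<forall>n. (n, c n) \<in> t) \<and> (\<forall>x\<in>X. \<forall>\<^sub>F n in sequentially. x \<in> B (c n)))"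

definition gdelta_coded :: "('c \<Rightarrow> 'a set) \<Rightarrow> (nat \<times> 'c) set \<Rightarrow> 'a set" where
  "gdelta_coded B t = (\<Inter>n. \<Union>c\<in>{c. (n, c) \<in> t}. B c)"

lemma omega_coded_subset: "omega_coded B t X \<Longrightarrow> Y \<subseteq> X \<Longrightarrow> omega_coded B t Y"
  unfolding omega_coded_def by (meson subset_trans)

lemma gamma_coded_subset: "gamma_coded B t X \<Longrightarrow> Y \<subseteq> X \<Longrightarrow> gamma_coded B t Y"
  unfolding gamma_coded_def by (meson subsetD)

text \<open>If the coded families fail to be \<open>\<omega>\<close>-covers of the points available, then finitely many of these points
are added to spoil the code for good. Otherwise a selection is secured for all points that may
still be added later. A fresh point is added in either case, so that the final set is large.\<close>

lemma gamma_sigma_stage: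
  fixes B :: "'c \<Rightarrow> (nat \<Rightarrow> bool) set"
  assumes op: "\<And>c. cantor_open (B c)" and C: "countable C" and inf: "infinite (snd p)"
  shows "\<exists>q Y. infinite (snd q) \<and> extends q p \<and> countable Y \<and> C \<subset> Y \<and> Y \<subseteq> C \<union> cube p \<and>
    (omega_coded B t Y \<longrightarrow> gamma_coded B t (Y \<union> cube q)) \<and>
    (\<forall>N. cantor_open (- (gdelta_coded B t \<inter> cell (fst q) (snd q) N)))"
proof -
  have "\<not> cube p \<subseteq> C" using uncountable_cube[OF inf] C countable_subset by blast
  then obtain x where x: "x \<in> cube p" "x \<notin> C" by blast
  have "\<exists>q Y. infinite (snd q) \<and> extends q p \<and> countable Y \<and> C \<subset> Y \<and> Y \<subseteq> C \<union> cube p \<and>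
    (omega_coded B t Y \<longrightarrow> gamma_coded B t (Y \<union> cube q))"
  proof (cases "omega_coded B t (insert x C \<union> cube p)")
    case True
    have om: "\<exists>U\<in>{B c |c. (k, c) \<in> t}. A \<subseteq> U" if A: "finite A" "A \<subseteq> insert x C \<union> cube p" for k A
    proof -
      obtain c where "(k, c) \<in> t" "A \<subseteq> B c" using True A unfolding omega_coded_def by metis
      then show ?thesis by auto
    qed
    show ?thesis
    proof (rule gamma_thinning[of p "insert x C" "\<lambda>k. {B c |c. (k, c) \<in> t}", OF inf _ _ om])
      show "countable (insert x C)" using C by simp
      show "cantor_open U" if "U \<in> {B c |c. (k, c) \<in> t}" for k U using that op by auto
    next
      fix q U
      assume q: "infinite (snd q)" "extends q p" "\<And>k. U k \<in> {B c |c. (k, c) \<in> t}"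
        "\<And>y. y \<in> insert x C \<union> cube q \<Longrightarrow> \<forall>\<^sub>F k in sequentially. y \<in> U k"
      have "\<forall>k. \<exists>c. (k, c) \<in> t \<and> U k = B c" using q(3) by blast
      then obtain c where c: "\<And>k. (k, c k) \<in> t" "\<And>k. U k = B (c k)" by metis
      have "gamma_coded B t (insert x C \<union> cube q)"
        unfolding gamma_coded_def using q(4) c by (intro exI[of _ c]) simp
      moreover have "C \<subset> insert x C" "insert x C \<subseteq> C \<union> cube p" "countable (insert x C)" using x C by auto
      ultimately show ?thesis using q(1,2) by blast
    qed
  next
    case False
    then obtain n A where A: "finite A" "A \<subseteq> insert x C \<union> cube p" "\<And>c. (n, c) \<in> t \<Longrightarrow> \<not> A \<subseteq> B c"
      unfolding omega_coded_def by blast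
    define Y where "Y = insert x C \<union> A"
    have "\<not> omega_coded B t Y"
      using A(1,3) unfolding omega_coded_def Y_def by (metis Un_upper2)
    moreover have "countable Y" "C \<subset> Y" "Y \<subseteq> C \<union> cube p"
      using A(1,2) C x by (auto simp: Y_def countable_finite)
    ultimately show ?thesis using inf extends_refl by blast
  qed
  then obtain q Y where q: "infinite (snd q)" "extends q p" and Y: "countable Y" "C \<subset> Y" "Y \<subseteq> C \<union> cube p"
    and g: "omega_coded B t Y \<Longrightarrow> gamma_coded B t (Y \<union> cube q)" by blast
  have op': "cantor_open (\<Union>c\<in>{c. (n, c) \<in> t}. B c)" for n
    unfolding cantor_open_def
  proof
    fix x assume "x \<in> (\<Union>c\<in>{c. (n, c) \<in> t}. B c)"
    then obtain c where c: "(n, c) \<in> t" "x \<in> B c" by auto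
    then obtain m where "\<forall>y. agree m x y \<longrightarrow> y \<in> B c" using op[of c] by (auto simp: cantor_open_def)
    then show "\<exists>m. \<forall>y. agree m x y \<longrightarrow> y \<in> (\<Union>c\<in>{c. (n, c) \<in> t}. B c)"
      using c(1) by (intro exI[of _ m]) auto
  qed
  obtain q' where q': "infinite (snd q')" "extends q' q"
    "\<And>N. cantor_open (- (gdelta_coded B t \<inter> cell (fst q') (snd q') N))"
    using sigma_refinement[of q "\<lambda>n. \<Union>c\<in>{c. (n, c) \<in> t}. B c", OF q(1) op']
    unfolding gdelta_coded_def[symmetric] by metis
  have "gamma_coded B t (Y \<union> cube q')" if "omega_coded B t Y"
    using gamma_coded_subset[OF g[OF that], of "Y \<union> cube q'"] extends_cube_subset[OF q'(2)] by auto
  then show ?thesis using q' Y extends_trans[OF q'(2) q(2)] by blast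
qed

text \<open>The conditions form a decreasing chain along a well-order of the reals with countable initial segments.
All points added at stage \<open>a\<close> or later lie in the cubes of the earlier stages, so the
final set is contained in the countable set \<open>Y a\<close> together with \<open>cube (p a)\<close>, and the decisions made at
stage \<open>a\<close> hold for it.\<close>

lemma CH_gamma_sigma_cantor:
  fixes B :: "'c::countable \<Rightarrow> (nat \<Rightarrow> bool) set"
  assumes CH: "Continuum_Hypothesis" and op: "\<And>c. cantor_open (B c)"
  obtains X where "\<exists>h :: real \<Rightarrow> nat \<Rightarrow> bool. inj h \<and> range h \<subseteq> X"
    and "\<And>t. omega_coded B t X \<Longrightarrow> gamma_coded B t X"
    and "\<And>t. \<exists>K D. (\<forall>N::nat. cantor_open (- K N)) \<and> countable D \<and> X \<inter> gdelta_coded B t = X \<inter> (\<Union>N. K N) \<union> D"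
proof -
  obtain r :: "real rel" where r: "wf r" "total r" "\<And>a. countable {b. (b, a) \<in> r}"
    using CH_well_order[OF CH] by blast
  obtain T :: "real \<Rightarrow> (nat \<times> 'c) set" where T: "surj T"
    using surj_real_sets_of_countable by blast
  define C where "C f a = (\<Union>b\<in>{b. (b, a) \<in> r}. snd (f b))"
    for f :: "real \<Rightarrow> ((nat \<Rightarrow> bool) \<times> nat set) \<times> (nat \<Rightarrow> bool) set" and a
  define R where "R f a v \<longleftrightarrow> infinite (snd (fst v)) \<and> (\<forall>b. (b, a) \<in> r \<longrightarrow> extends (fst v) (fst (f b))) \<and>
     countable (snd v) \<and> C f a \<subset> snd v \<and> (\<forall>b. (b, a) \<in> r \<longrightarrow> snd v \<subseteq> C f a \<union> cube (fst (f b))) \<and>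
     (omega_coded B (T a) (snd v) \<longrightarrow> gamma_coded B (T a) (snd v \<union> cube (fst v))) \<and>
     (\<forall>N. cantor_open (- (gdelta_coded B (T a) \<inter> cell (fst (fst v)) (snd (fst v)) N)))"
    for f :: "real \<Rightarrow> ((nat \<Rightarrow> bool) \<times> nat set) \<times> (nat \<Rightarrow> bool) set" and a v
  have "\<exists>f. \<forall>a. R f a (f a)"
  proof (rule dependent_wf_choice[OF r(1)])
    fix f g :: "real \<Rightarrow> ((nat \<Rightarrow> bool) \<times> nat set) \<times> (nat \<Rightarrow> bool) set" and a v
    assume fg: "\<And>z. (z, a) \<in> r \<Longrightarrow> f z = g z"
    then have "C f a = C g a" by (simp add: C_def)
    then show "R f a v = R g a v" using fg unfolding R_def by simp
  next
    fix a f assume IH: "\<And>b. (b, a) \<in> r \<Longrightarrow> R f b (f b)"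
    have "\<exists>p. infinite (snd p) \<and> (\<forall>p'\<in>(\<lambda>b. fst (f b)) ` {b. (b, a) \<in> r}. extends p p')"
    proof (rule lower_bound_countable_chain[of "(\<lambda>b. fst (f b)) ` {b. (b, a) \<in> r}"])
      show "countable ((\<lambda>b. fst (f b)) ` {b. (b, a) \<in> r})" using r(3) by simp
      show "infinite (snd p)" if "p \<in> (\<lambda>b. fst (f b)) ` {b. (b, a) \<in> r}" for p
        using that IH by (auto simp: R_def)
      fix p q assume "p \<in> (\<lambda>b. fst (f b)) ` {b. (b, a) \<in> r}" "q \<in> (\<lambda>b. fst (f b)) ` {b. (b, a) \<in> r}"
      then obtain b d where bd: "p = fst (f b)" "q = fst (f d)" "(b, a) \<in> r" "(d, a) \<in> r" by auto
      consider "b = d" | "(b, d) \<in> r" | "(d, b) \<in> r" using r(2) by (auto simp: total_on_def)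
      then show "extends p q \<or> extends q p"
        using bd IH[of b] IH[of d] extends_refl unfolding R_def by cases auto
    qed blast
    then obtain p where p: "infinite (snd p)" "\<And>b. (b, a) \<in> r \<Longrightarrow> extends p (fst (f b))" by blast
    have "countable (C f a)" unfolding C_def using r(3) IH by (intro countable_UN) (auto simp: R_def)
    from gamma_sigma_stage[of B, OF op this p(1), of "T a"] obtain q Y where
      q: "infinite (snd q)" "extends q p" "countable Y" "C f a \<subset> Y" "Y \<subseteq> C f a \<union> cube p"
        "omega_coded B (T a) Y \<longrightarrow> gamma_coded B (T a) (Y \<union> cube q)"
        "\<forall>N. cantor_open (- (gdelta_coded B (T a) \<inter> cell (fst q) (snd q) N))" by blast
    have "Y \<subseteq> C f a \<union> cube (fst (f b))" if "(b, a) \<in> r" for b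
      using q(5) extends_cube_subset[OF p(2)[OF that]] by blast
    then have "R f a (q, Y)"
      using q p extends_trans unfolding R_def fst_conv snd_conv by blast
    then show "\<exists>v. R f a v" ..
  qed
  then obtain f where f: "\<And>a. R f a (f a)" by blast
  define p where "p a = fst (f a)" for a
  define Y where "Y a = snd (f a)" for a
  have Yc: "countable (Y a)" for a using f by (simp add: R_def Y_def)
  define X where "X = (\<Union>a. Y a)"
  have sub: "X \<subseteq> Y a \<union> cube (p a)" for a
  proof
    fix x assume "x \<in> X"
    then obtain b where "x \<in> Y b" by (auto simp: X_def)
    \<comment> \<open>Consider the first stage at which \<open>x\<close> appears.\<close>
    then have "b \<in> {b. x \<in> Y b}" by simp
    from wfE_min[OF r(1) this] obtain b where "b \<in> {b. x \<in> Y b}"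
      "\<And>d. (d, b) \<in> r \<Longrightarrow> d \<notin> {b. x \<in> Y b}" by metis
    then have b: "x \<in> Y b" and least: "\<And>d. (d, b) \<in> r \<Longrightarrow> x \<notin> Y d" by auto
    consider "b = a" | "(b, a) \<in> r" | "(a, b) \<in> r" using r(2) by (auto simp: total_on_def)
    then show "x \<in> Y a \<union> cube (p a)"
    proof cases
      case 1
      then show ?thesis using b by simp
    next
      case 2
      then have "x \<in> C f a" using b by (auto simp: C_def Y_def)
      then show ?thesis using f[of a] by (auto simp: R_def Y_def)
    next
      case 3
      then have "Y b \<subseteq> C f b \<union> cube (p a)" using f[of b] by (auto simp: R_def Y_def p_def)
      moreover have "x \<notin> C f b" using least by (auto simp: C_def Y_def)
      ultimately show ?thesis using b by blast
    qed
  qed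
  have "\<exists>x. x \<in> Y a \<and> x \<notin> C f a" for a using f[of a] by (auto simp: R_def Y_def)
  then obtain h where h: "\<And>a. h a \<in> Y a" "\<And>a. h a \<notin> C f a" by metis
  have "inj h"
  proof (rule injI, rule ccontr)
    fix a b assume "h a = h b" "a \<noteq> b"
    then consider "(b, a) \<in> r" | "(a, b) \<in> r" using r(2) by (auto simp: total_on_def)
    then show False
    proof cases
      case 1
      then have "h b \<in> C f a" using h(1)[of b] by (auto simp: C_def Y_def)
      then show False using h(2)[of a] \<open>h a = h b\<close> by simp
    next
      case 2
      then have "h a \<in> C f b" using h(1)[of a] by (auto simp: C_def Y_def)
      then show False using h(2)[of b] \<open>h a = h b\<close> by simp
    qed
  qed
  show ?thesis
  proof
    show "\<exists>h :: real \<Rightarrow> nat \<Rightarrow> bool. inj h \<and> range h \<subseteq> X"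
      using \<open>inj h\<close> h(1) by (auto simp: X_def)
  next
    fix t assume om: "omega_coded B t X"
    obtain a where a: "T a = t" using T by (metis surjD)
    have "omega_coded B t (Y a)" using om by (rule omega_coded_subset) (auto simp: X_def)
    then have "gamma_coded B t (Y a \<union> cube (p a))" using f[of a] a by (simp add: R_def Y_def p_def)
    then show "gamma_coded B t X" using sub by (rule gamma_coded_subset)
  next
    fix t
    obtain a where a: "T a = t" using T by (metis surjD)
    define K where "K N = gdelta_coded B t \<inter> cell (fst (p a)) (snd (p a)) N" for N
    have "cantor_open (- K N)" for N using f[of a] a by (simp add: R_def p_def K_def)
    moreover have "(\<Union>N. K N) = gdelta_coded B t \<inter> cube (p a)" by (auto simp: K_def cube_def)
    then have "X \<inter> gdelta_coded B t = X \<inter> (\<Union>N. K N) \<union> (Y a \<inter> X \<inter> gdelta_coded B t)"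
      using sub[of a] by auto
    moreover have "countable (Y a \<inter> X \<inter> gdelta_coded B t)" using Yc by (simp add: countable_Int1)
    ultimately show "\<exists>K D. (\<forall>N::nat. cantor_open (- K N)) \<and> countable D \<and>
       X \<inter> gdelta_coded B t = X \<inter> (\<Union>N. K N) \<union> D" by blast
  qed
qed

section \<open>Transfer to the real line\<close>

text \<open>The standard homeomorphism onto the middle-thirds Cantor set.\<close>

definition cantor_real :: "(nat \<Rightarrow> bool) \<Rightarrow> real" where
  "cantor_real x = (\<Sum>n. 2 * of_bool (x n) / 3 ^ Suc n)"

lemma cantor_real_bounds:
  shows summable_cantor_real: "summable (\<lambda>n. 2 * of_bool (x n) / 3 ^ Suc n :: real)"
    and cantor_real_ge_0: "0 \<le> cantor_real x"
    and cantor_real_le_1: "cantor_real x \<le> 1"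
proof -
  have "(\<lambda>n. (1/3) ^ n) sums (1 / (1 - 1/3 :: real))" by (rule geometric_sums) simp
  then have "(\<lambda>n. 2/3 * (1/3) ^ n) sums (2/3 * (1 / (1 - 1/3 :: real)))" by (rule sums_mult)
  moreover have "(\<lambda>n. 2/3 * (1/3) ^ n) = (\<lambda>n. 2 / 3 ^ Suc n :: real)"
    by (simp add: fun_eq_iff power_one_over field_simps)
  ultimately have s: "(\<lambda>n. 2 / 3 ^ Suc n :: real) sums 1" by simp
  show 1: "summable (\<lambda>n. 2 * of_bool (x n) / 3 ^ Suc n :: real)"
    by (rule summable_comparison_test[OF _ sums_summable[OF s]]) (auto simp: of_bool_def)
  show "0 \<le> cantor_real x" unfolding cantor_real_def by (intro suminf_nonneg 1) simp
  have "cantor_real x \<le> (\<Sum>n. 2 / 3 ^ Suc n)"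
    unfolding cantor_real_def by (intro suminf_le 1 sums_summable[OF s]) (auto simp: of_bool_def)
  then show "cantor_real x \<le> 1" using sums_unique[OF s] by simp
qed

lemma cantor_real_rec: "cantor_real x = (2 * of_bool (x 0) + cantor_real (\<lambda>n. x (Suc n))) / 3"
proof -
  have "cantor_real x = (\<Sum>n. 2 * of_bool (x (Suc n)) / 3 ^ Suc (Suc n)) + 2 * of_bool (x 0) / 3 ^ Suc 0"
    unfolding cantor_real_def using suminf_split_head[OF summable_cantor_real[of x]] by simp
  also have "(\<Sum>n. 2 * of_bool (x (Suc n)) / 3 ^ Suc (Suc n) :: real) = (\<Sum>n. (1/3) * (2 * of_bool (x (Suc n)) / 3 ^ Suc n))"
    by (simp add: field_simps)
  also have "\<dots> = (1/3) * cantor_real (\<lambda>n. x (Suc n))"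
    unfolding cantor_real_def by (rule suminf_mult[OF summable_cantor_real])
  finally show ?thesis by (simp add: field_simps)
qed

lemma cantor_real_diff_rec:
  "cantor_real x - cantor_real y = (2 * (of_bool (x 0) - of_bool (y 0)) +
     (cantor_real (\<lambda>n. x (Suc n)) - cantor_real (\<lambda>n. y (Suc n)))) / 3"
  by (subst (1 2) cantor_real_rec) (simp add: field_simps)

lemma cantor_real_continuous: "agree m x y \<Longrightarrow> \<bar>cantor_real x - cantor_real y\<bar> \<le> (1/3) ^ m"
proof (induction m arbitrary: x y)
  case 0
  then show ?case
    using cantor_real_ge_0[of x] cantor_real_le_1[of x] cantor_real_ge_0[of y] cantor_real_le_1[of y] by simp
next
  case (Suc m)
  have "x 0 = y 0" "agree m (\<lambda>n. x (Suc n)) (\<lambda>n. y (Suc n))" using Suc.prems by (auto simp: agree_def)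
  then show ?case
    using Suc.IH[of "\<lambda>n. x (Suc n)" "\<lambda>n. y (Suc n)"] by (simp add: cantor_real_diff_rec[of x y])
qed

lemma cantor_real_separates: "\<bar>cantor_real x - cantor_real y\<bar> < (1/3) ^ m \<Longrightarrow> agree m x y"
proof (induction m arbitrary: x y)
  case 0
  then show ?case by (simp add: agree_def)
next
  case (Suc m)
  let ?x = "\<lambda>n. x (Suc n)" and ?y = "\<lambda>n. y (Suc n)"
  have lt: "\<bar>cantor_real x - cantor_real y\<bar> < (1/3) * (1/3) ^ m" using Suc.prems by simp
  have "(1/3::real) ^ m \<le> 1" by (simp add: power_le_one)
  moreover have "\<bar>cantor_real ?x - cantor_real ?y\<bar> \<le> 1"
    using cantor_real_ge_0[of ?x] cantor_real_ge_0[of ?y] cantor_real_le_1[of ?x] cantor_real_le_1[of ?y]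
    by linarith
  ultimately have "x 0 = y 0"
    using lt unfolding cantor_real_diff_rec[of x y] by (cases "x 0"; cases "y 0"; simp; linarith)
  then have "\<bar>cantor_real ?x - cantor_real ?y\<bar> < (1/3) ^ m"
    using lt by (simp add: cantor_real_diff_rec[of x y])
  then have "agree m ?x ?y" by (rule Suc.IH)
  with \<open>x 0 = y 0\<close> show ?case by (auto simp: agree_def less_Suc_eq_0_disj)
qed

lemma inj_cantor_real: "inj cantor_real"
proof (rule injI, rule ext)
  fix x y n assume "cantor_real x = cantor_real y"
  then have "agree (Suc n) x y" by (intro cantor_real_separates) simp
  then show "x n = y n" by (simp add: agree_def)
qed

lemma cantor_open_vimage:
  assumes "open U"
  shows "cantor_open (cantor_real -` U)"
  unfolding cantor_open_def
proof
  fix x assume "x \<in> cantor_real -` U"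
  then obtain e where e: "e > 0" "\<And>r. dist r (cantor_real x) < e \<Longrightarrow> r \<in> U"
    using assms by (auto simp: open_dist)
  obtain m where "(1/3::real) ^ m < e" using real_arch_pow_inv[OF e(1), of "1/3"] by auto
  then have "y \<in> cantor_real -` U" if "agree m x y" for y
    using e(2)[of "cantor_real y"] cantor_real_continuous[OF that] by (simp add: dist_real_def)
  then show "\<exists>m. \<forall>y. agree m x y \<longrightarrow> y \<in> cantor_real -` U" by blast
qed

lemma closedin_cantor_image:
  assumes "cantor_open (- K)"
  shows "closedin (top_of_set (cantor_real ` X)) (cantor_real ` (X \<inter> K))"
proof -
  have "cantor_real ` X \<inter> closure (cantor_real ` K) \<subseteq> cantor_real ` K"
  proof
    fix r assume r: "r \<in> cantor_real ` X \<inter> closure (cantor_real ` K)"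
    then obtain x where x: "r = cantor_real x" by auto
    have "x \<in> K"
    proof (rule ccontr)
      assume "x \<notin> K"
      then obtain m where m: "\<And>y. agree m x y \<Longrightarrow> y \<notin> K"
        using assms by (auto simp: cantor_open_def)
      have "r \<in> closure (cantor_real ` K)" using r by blast
      then have "\<exists>v\<in>cantor_real ` K. dist v r < (1/3) ^ m"
        unfolding closure_approachable by (elim allE[of _ "(1/3) ^ m"]) simp
      then obtain y where y: "y \<in> K" "dist (cantor_real y) (cantor_real x) < (1/3) ^ m"
        unfolding x by blast
      then have "agree m x y" by (intro cantor_real_separates) (simp add: dist_real_def abs_minus_commute)
      then show False using m y(1) by blast
    qed
    then show "r \<in> cantor_real ` K" using x by blast
  qed
  then have "cantor_real ` (X \<inter> K) = cantor_real ` X \<inter> closure (cantor_real ` K)"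
    using closure_subset[of "cantor_real ` K"] inj_cantor_real by (auto simp: inj_image_mem_iff image_Int)
  then show ?thesis unfolding closedin_closed by (intro exI[of _ "closure (cantor_real ` K)"]) simp
qed

definition rat_open :: "(rat \<times> rat) list \<Rightarrow> real set" where
  "rat_open l = (\<Union>(a, b)\<in>set l. {of_rat a<..<of_rat b})"

lemma open_rat_open: "open (rat_open l)"
  by (auto simp: rat_open_def)

lemma rat_open_between:
  assumes "finite A" "open U" "A \<subseteq> U"
  shows "\<exists>l. A \<subseteq> rat_open l \<and> rat_open l \<subseteq> U"
  using assms(1,3)
proof (induction A)
  case empty
  then show ?case by (intro exI[of _ "[]"]) (simp add: rat_open_def)
next
  case (insert x A)
  then obtain l where l: "A \<subseteq> rat_open l" "rat_open l \<subseteq> U" by auto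
  obtain e where e: "e > 0" "\<And>r. dist r x < e \<Longrightarrow> r \<in> U"
    using insert.prems assms(2) by (auto simp: open_dist)
  obtain a b where a: "x - e < of_rat a" "of_rat a < x" and b: "x < of_rat b" "of_rat b < x + e"
    using of_rat_dense[of "x - e" x] of_rat_dense[of x "x + e"] e(1) by auto
  have "{of_rat a<..<of_rat b} \<subseteq> U"
    using a b e(2) by (auto simp: dist_real_def abs_if)
  then have "insert x A \<subseteq> rat_open ((a, b) # l) \<and> rat_open ((a, b) # l) \<subseteq> U"
    using l a b by (auto simp: rat_open_def)
  then show ?case by blast
qed

text \<open>This form of the selection principle counts indices instead of members of the range.
It is easier to transport along maps of covers that are not injective.\<close>

definition eventually_selective :: "real set \<Rightarrow> bool" where
  "eventually_selective X \<longleftrightarrow> (\<forall>\<U>. (\<forall>n::nat. \<U> n \<in> open_omega_covers X) \<longrightarrow>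
     (\<exists>U. (\<forall>n. U n \<in> \<U> n) \<and> (\<forall>x\<in>X. \<forall>\<^sub>F n in sequentially. x \<in> U n)))"

lemma open_omega_coversD:
  assumes "\<U> \<in> open_omega_covers X"
  shows "U \<in> \<U> \<Longrightarrow> openin (top_of_set X) U" "X \<notin> \<U>"
    "finite A \<Longrightarrow> A \<subseteq> X \<Longrightarrow> \<exists>U\<in>\<U>. A \<subseteq> U"
  using assms by (simp_all add: open_omega_covers_def)

text \<open>The range of such a selection is infinite: a member chosen infinitely often would contain
every point of \<open>X\<close>, but \<open>X\<close> itself is no member of an \<open>\<omega>\<close>-cover.\<close>

lemma eventually_selective_imp_gamma_set:
  assumes "eventually_selective X"
  shows "gamma_set X"
  unfolding gamma_set_def S1_def
proof (intro allI impI)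
  fix \<U> :: "nat \<Rightarrow> real set set" assume \<U>: "\<forall>n. \<U> n \<in> open_omega_covers X"
  then obtain U where U: "\<And>n. U n \<in> \<U> n" and ev: "\<And>x. x \<in> X \<Longrightarrow> \<forall>\<^sub>F n in sequentially. x \<in> U n"
    using assms unfolding eventually_selective_def by blast
  have op: "openin (top_of_set X) (U n)" and ne: "U n \<noteq> X" for n
    using open_omega_coversD(1,2)[OF \<U>[rule_format, of n]] U[of n] by auto
  have "infinite (range U)"
  proof
    assume "finite (range U)"
    then obtain n0 where inf: "infinite {n \<in> UNIV. U n = U n0}"
      using pigeonhole_infinite[of UNIV U] by auto
    have "X \<subseteq> U n0"
    proof
      fix x assume "x \<in> X"
      then obtain N where N: "\<And>n. n \<ge> N \<Longrightarrow> x \<in> U n" using ev by (auto simp: eventually_sequentially)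
      obtain n where "n \<ge> N" "U n = U n0" using inf unfolding infinite_nat_iff_unbounded_le by auto
      then show "x \<in> U n0" using N by blast
    qed
    moreover have "U n0 \<subseteq> X" using openin_subset[OF op] by simp
    ultimately show False using ne by blast
  qed
  moreover have "finite {V \<in> range U. x \<notin> V}" if x: "x \<in> X" for x
  proof -
    obtain N where N: "\<And>n. n \<ge> N \<Longrightarrow> x \<in> U n" using ev[OF x] by (auto simp: eventually_sequentially)
    have "{V \<in> range U. x \<notin> V} \<subseteq> U ` {..<N}" using N by (force simp: not_le[symmetric])
    then show ?thesis using finite_subset by blast
  qed
  ultimately have "range U \<in> open_gamma_covers X" using op by (auto simp: open_gamma_covers_def)
  then show "\<exists>U. (\<forall>n. U n \<in> \<U> n) \<and> range U \<in> open_gamma_covers X" using U by blast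
qed

text \<open>Every \<open>\<omega>\<close>-cover is refined by the finite unions of rational intervals whose traces on \<open>X\<close>
lie in its members.\<close>

lemma eventually_selective_if_coded:
  assumes "\<And>t. omega_coded rat_open t X \<Longrightarrow> gamma_coded rat_open t X"
  shows "eventually_selective X"
  unfolding eventually_selective_def
proof (intro allI impI)
  fix \<U> :: "nat \<Rightarrow> real set set" assume \<U>: "\<forall>n. \<U> n \<in> open_omega_covers X"
  define t where "t = {(n, l). \<exists>U\<in>\<U> n. X \<inter> rat_open l \<subseteq> U}"
  have "omega_coded rat_open t X"
    unfolding omega_coded_def
  proof (intro allI impI)
    fix n A assume A: "finite A" "A \<subseteq> X"
    then obtain U where U: "U \<in> \<U> n" "A \<subseteq> U"
      using open_omega_coversD(3)[OF \<U>[rule_format, of n]] by blast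
    then have "openin (top_of_set X) U" using open_omega_coversD(1)[OF \<U>[rule_format, of n]] by blast
    then obtain V where V: "open V" "U = X \<inter> V" unfolding openin_open by blast
    obtain l where "A \<subseteq> rat_open l" "rat_open l \<subseteq> V"
      using rat_open_between[OF A(1) V(1)] U(2) V(2) by auto
    then have "X \<inter> rat_open l \<subseteq> U" using V(2) by auto
    then have "(n, l) \<in> t" using U(1) unfolding t_def by auto
    then show "\<exists>l. (n, l) \<in> t \<and> A \<subseteq> rat_open l" using \<open>A \<subseteq> rat_open l\<close> by blast
  qed
  from assms[OF this] obtain l where l: "\<And>n. (n, l n) \<in> t"
    "\<And>x. x \<in> X \<Longrightarrow> \<forall>\<^sub>F n in sequentially. x \<in> rat_open (l n)" unfolding gamma_coded_def by blast
  have "\<forall>n. \<exists>U. U \<in> \<U> n \<and> X \<inter> rat_open (l n) \<subseteq> U" using l(1) by (auto simp: t_def)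
  then obtain U where U: "\<And>n. U n \<in> \<U> n" "\<And>n. X \<inter> rat_open (l n) \<subseteq> U n" by metis
  have "\<forall>\<^sub>F n in sequentially. x \<in> U n" if "x \<in> X" for x
    using l(2)[OF that] by eventually_elim (use U(2) that in blast)
  then show "\<exists>U. (\<forall>n. U n \<in> \<U> n) \<and> (\<forall>x\<in>X. \<forall>\<^sub>F n in sequentially. x \<in> U n)" using U(1) by blast
qed

lemma sigma_set_if_coded:
  assumes "\<And>t. fsigma_in (top_of_set X) (X \<inter> gdelta_coded rat_open t)"
  shows "sigma_set X"
  unfolding sigma_set_def
proof (intro allI impI)
  fix A assume "gdelta_in (top_of_set X) A"
  then obtain C :: "nat \<Rightarrow> real set" where C: "\<forall>n. openin (top_of_set X) (C n)" "\<Inter> (range C) = A"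
    unfolding gdelta_in_descending by metis
  have "\<forall>n. \<exists>V. open V \<and> C n = X \<inter> V" using C(1) by (simp add: openin_open)
  then obtain V where V: "\<And>n. open (V n)" "\<And>n. C n = X \<inter> V n" by metis
  define t where "t = {(n, l). rat_open l \<subseteq> V n}"
  have "(\<Union>l\<in>{l. (n, l) \<in> t}. rat_open l) = V n" for n
  proof
    show "(\<Union>l\<in>{l. (n, l) \<in> t}. rat_open l) \<subseteq> V n" by (auto simp: t_def)
    show "V n \<subseteq> (\<Union>l\<in>{l. (n, l) \<in> t}. rat_open l)"
    proof
      fix x assume "x \<in> V n"
      then show "x \<in> (\<Union>l\<in>{l. (n, l) \<in> t}. rat_open l)"
        using rat_open_between[of "{x}" "V n"] V(1) by (auto simp: t_def)
    qed
  qed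
  then have "X \<inter> gdelta_coded rat_open t = A"
    using C(2) V(2) by (auto simp: gdelta_coded_def)
  then show "fsigma_in (top_of_set X) A" using assms by metis
qed

lemma CH_selective_sigma:
  assumes "Continuum_Hypothesis"
  obtains X and h :: "real \<Rightarrow> real" where "X \<subseteq> {0..1}" "inj h" "range h \<subseteq> X"
    "eventually_selective X" "sigma_set X"
proof -
  define B where "B l = cantor_real -` rat_open l" for l
  have B: "cantor_open (B l)" for l
    unfolding B_def by (rule cantor_open_vimage[OF open_rat_open])
  show ?thesis
  proof (rule CH_gamma_sigma_cantor[of B, OF assms B])
    fix X
    assume h: "\<exists>h :: real \<Rightarrow> nat \<Rightarrow> bool. inj h \<and> range h \<subseteq> X"
      and g: "\<And>t. omega_coded B t X \<Longrightarrow> gamma_coded B t X"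
      and s: "\<And>t. \<exists>K D. (\<forall>N::nat. cantor_open (- K N)) \<and> countable D \<and>
        X \<inter> gdelta_coded B t = X \<inter> (\<Union>N. K N) \<union> D"
    obtain h :: "real \<Rightarrow> nat \<Rightarrow> bool" where h: "inj h" "range h \<subseteq> X" using h by blast
    let ?X = "cantor_real ` X"
    have 1: "?X \<subseteq> {0..1}" using cantor_real_ge_0 cantor_real_le_1 by auto
    have 2: "inj (cantor_real \<circ> h)" "range (cantor_real \<circ> h) \<subseteq> ?X"
      using h inj_cantor_real by (auto intro: inj_compose)
    have 3: "eventually_selective ?X"
    proof (rule eventually_selective_if_coded)
      fix t assume t: "omega_coded rat_open t ?X"
      have "omega_coded B t X"
        unfolding omega_coded_def
      proof (intro allI impI)
        fix n A assume "finite A" "A \<subseteq> X"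
        then have "finite (cantor_real ` A)" "cantor_real ` A \<subseteq> ?X" by auto
        then obtain c where "(n, c) \<in> t" "cantor_real ` A \<subseteq> rat_open c"
          using t unfolding omega_coded_def by blast
        then show "\<exists>c. (n, c) \<in> t \<and> A \<subseteq> B c" unfolding B_def by blast
      qed
      from g[OF this] show "gamma_coded rat_open t ?X"
        unfolding gamma_coded_def B_def by auto
    qed
    have 4: "sigma_set ?X"
    proof (rule sigma_set_if_coded)
      fix t
      obtain K D where KD: "\<And>N::nat. cantor_open (- K N)" "countable D"
        "X \<inter> gdelta_coded B t = X \<inter> (\<Union>N. K N) \<union> D" using s by metis
      have "?X \<inter> gdelta_coded rat_open t = cantor_real ` (X \<inter> gdelta_coded B t)"
        by (auto simp: gdelta_coded_def B_def)
      also have "\<dots> = (\<Union>N. cantor_real ` (X \<inter> K N)) \<union> (\<Union>x\<in>D. {cantor_real x})"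
        unfolding KD(3) by auto
      finally have eq: "?X \<inter> gdelta_coded rat_open t = \<dots>" .
      have "fsigma_in (top_of_set ?X) (\<Union>N. cantor_real ` (X \<inter> K N))"
        using KD(1) closedin_cantor_image by (intro fsigma_in_Union) (auto intro: closed_imp_fsigma_in)
      moreover have "D \<subseteq> X" using KD(3) by auto
      then have "fsigma_in (top_of_set ?X) (\<Union>x\<in>D. {cantor_real x})"
        using KD(2) by (intro fsigma_in_Union) (auto intro!: closed_imp_fsigma_in simp: closedin_closed_eq closed_subset)
      ultimately show "fsigma_in (top_of_set ?X) (?X \<inter> gdelta_coded rat_open t)"
        unfolding eq by (rule fsigma_in_Un)
    qed
    show ?thesis using that[of ?X "cantor_real \<circ> h"] 1 2 3 4 by blast
  qed
qed

section \<open>Doubling destroys heredity\<close>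

definition double :: "real set \<Rightarrow> real set" where
  "double X = X \<union> (\<lambda>x. x + 2) ` X"

text \<open>From an \<open>\<omega>\<close>-cover of the double one obtains an \<open>\<omega>\<close>-cover of \<open>X\<close> by taking the points both copies
of which are covered.\<close>

lemma eventually_selective_double:
  assumes "eventually_selective X"
  shows "eventually_selective (double X)"
  unfolding eventually_selective_def
proof (intro allI impI)
  fix \<U> :: "nat \<Rightarrow> real set set" assume \<U>: "\<forall>n. \<U> n \<in> open_omega_covers (double X)"
  define s where "s U = {x \<in> X. x \<in> U \<and> x + 2 \<in> U}" for U
  have "s ` \<U> n \<in> open_omega_covers X" for n
  proof -
    have op: "openin (top_of_set X) (s U)" and ne: "s U \<noteq> X" if "U \<in> \<U> n" for U
    proof -
      have U: "openin (top_of_set (double X)) U" "U \<noteq> double X"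
        using that open_omega_coversD(1,2)[OF \<U>[rule_format, of n]] by auto
      then obtain V where V: "open V" "U = double X \<inter> V" by (auto simp: openin_open)
      have "open ((\<lambda>x. x + 2) -` V)" using V(1) by (intro open_vimage continuous_intros)
      then have "open (V \<inter> (\<lambda>x. x + 2) -` V)" using V(1) by (rule open_Int[rotated])
      moreover have "s U = X \<inter> (V \<inter> (\<lambda>x. x + 2) -` V)" unfolding s_def V(2) double_def by auto
      ultimately show "openin (top_of_set X) (s U)" by (auto simp: openin_open)
      show "s U \<noteq> X" using U(2) V(2) by (auto simp: s_def double_def)
    qed
    moreover have "\<exists>V\<in>s ` \<U> n. A \<subseteq> V" if A: "finite A" "A \<subseteq> X" for A
    proof -
      have "finite (double A)" "double A \<subseteq> double X" using A by (auto simp: double_def)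
      then obtain U where "U \<in> \<U> n" "double A \<subseteq> U"
        using open_omega_coversD(3)[OF \<U>[rule_format, of n]] by blast
      moreover have "A \<subseteq> s U" using A(2) \<open>double A \<subseteq> U\<close> by (auto simp: s_def double_def)
      ultimately show ?thesis by blast
    qed
    ultimately show ?thesis unfolding open_omega_covers_def by blast
  qed
  then have "\<exists>W. (\<forall>n. W n \<in> s ` \<U> n) \<and> (\<forall>x\<in>X. \<forall>\<^sub>F n in sequentially. x \<in> W n)"
    using assms[unfolded eventually_selective_def, THEN spec, of "\<lambda>n. s ` \<U> n"] by simp
  then obtain W where W: "\<And>n. W n \<in> s ` \<U> n" "\<And>x. x \<in> X \<Longrightarrow> \<forall>\<^sub>F n in sequentially. x \<in> W n"
    by blast
  have "\<forall>n. \<exists>U. U \<in> \<U> n \<and> W n = s U" using W(1) by blast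
  then obtain U where U: "\<And>n. U n \<in> \<U> n" "\<And>n. W n = s (U n)" by metis
  have ev: "\<forall>\<^sub>F n in sequentially. x \<in> U n \<and> x + 2 \<in> U n" if "x \<in> X" for x
    using W(2)[OF that] by eventually_elim (simp add: U(2) s_def)
  have "\<forall>\<^sub>F n in sequentially. y \<in> U n" if "y \<in> double X" for y
    using that unfolding double_def by (auto dest!: ev elim: eventually_mono)
  then show "\<exists>U. (\<forall>n. U n \<in> \<U> n) \<and> (\<forall>x\<in>double X. \<forall>\<^sub>F n in sequentially. x \<in> U n)"
    using U(1) by blast
qed

lemma gdelta_in_shift:
  fixes a :: real
  assumes "gdelta_in euclidean T"
  shows "gdelta_in euclidean ((\<lambda>x. x + a) -` T)"
proof -
  obtain C where C: "\<And>n. open (C n)" "\<And>n. C (Suc n) \<subseteq> C n" "\<Inter> (range C) = T"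
    using assms unfolding gdelta_in_descending by auto
  have "open ((\<lambda>x. x + a) -` C n)" for n using C(1) by (intro open_vimage continuous_intros)
  moreover have "(\<Inter>n. (\<lambda>x. x + a) -` C n) = (\<lambda>x. x + a) -` T" using C(3) by auto
  ultimately show ?thesis
    unfolding gdelta_in_descending
    by (intro exI[of _ "\<lambda>n. (\<lambda>x. x + a) -` C n"] conjI allI vimage_mono[OF C(2)]) simp_all
qed

lemma fsigma_in_shift:
  fixes a :: real
  assumes "fsigma_in euclidean T"
  shows "fsigma_in euclidean ((\<lambda>x. x + a) -` T)"
proof -
  have "gdelta_in euclidean (UNIV - T)" using assms by (simp add: fsigma_in_gdelta_in)
  then have "gdelta_in euclidean ((\<lambda>x. x + a) -` (UNIV - T))" by (rule gdelta_in_shift)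
  moreover have "(\<lambda>x. x + a) -` (UNIV - T) = UNIV - (\<lambda>x. x + a) -` T" by auto
  ultimately show ?thesis by (simp add: fsigma_in_gdelta_in)
qed

lemma sigma_set_double:
  assumes X: "X \<subseteq> {0..1}" and s: "sigma_set X"
  shows "sigma_set (double X)"
  unfolding sigma_set_def
proof (intro allI impI)
  fix A assume "gdelta_in (top_of_set (double X)) A"
  then obtain T where T: "gdelta_in euclidean T" "A = T \<inter> double X"
    unfolding gdelta_in_subtopology by blast
  have main: "\<exists>S. fsigma_in euclidean S \<and> T' \<inter> X = S \<inter> X" if "gdelta_in euclidean T'" for T'
    using s that unfolding sigma_set_def gdelta_in_subtopology fsigma_in_subtopology by blast
  obtain S1 where S1: "fsigma_in euclidean S1" "T \<inter> X = S1 \<inter> X" using main[OF T(1)] by blast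
  obtain S2 where S2: "fsigma_in euclidean S2" "(\<lambda>x. x + 2) -` T \<inter> X = S2 \<inter> X"
    using main[OF gdelta_in_shift[OF T(1)]] by blast
  define S where "S = (S1 \<inter> {..1}) \<union> ((\<lambda>x. x + (-2)) -` S2 \<inter> {2..})"
  have "fsigma_in euclidean S"
    unfolding S_def
    by (intro fsigma_in_Un fsigma_in_Int fsigma_in_shift S1 S2 closed_imp_fsigma_in) auto
  moreover have "A = S \<inter> double X"
  proof -
    have "y \<in> T \<longleftrightarrow> y \<in> S" if y: "y \<in> double X" for y
    proof -
      consider "y \<in> X" | x where "x \<in> X" "y = x + 2" using y by (auto simp: double_def)
      then show ?thesis
      proof cases
        case 1
        then show ?thesis using S1(2) X by (auto simp: S_def)
      next
        case 2
        then have "x \<le> 1" "0 \<le> x" using X by auto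
        then show ?thesis using S2(2) 2 by (auto simp: S_def)
      qed
    qed
    then show ?thesis using T(2) by blast
  qed
  ultimately show "fsigma_in (top_of_set (double X)) A" unfolding fsigma_in_subtopology by blast
qed

lemma surj_real_sequences_of_countable:
  obtains T :: "real \<Rightarrow> nat \<Rightarrow> 'b::countable" where "surj T"
proof -
  obtain T :: "real \<Rightarrow> (nat \<times> 'b) set" where T: "surj T" using surj_real_sets_of_countable by blast
  define S where "S x n = (SOME c. (n, c) \<in> T x)" for x n
  have "\<exists>x. S x = f" for f
  proof -
    obtain x where "T x = {(n, f n) | n. True}" using T by (metis surjD)
    then have "S x = f" by (auto simp: S_def fun_eq_iff)
    then show ?thesis ..
  qed
  then have "surj S" by (metis surjI)
  then show ?thesis using that by blast
qed

text \<open>For \<open>Z \<subseteq> X\<close> take \<open>Y\<close> to consist of the lower copy of \<open>Z\<close> and the upper copy of \<open>X - Z\<close>. For disjoint finite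
unions \<open>U\<close> and \<open>V\<close> of rational intervals, the part of \<open>Y\<close> lying in the lower copy of \<open>U\<close> or the upper copy of \<open>V\<close> is
open, and these parts form an \<open>\<omega>\<close>-cover, since disjoint finite sets can be separated. A
\<open>\<gamma>\<close>-subcover would present \<open>Z\<close> as the pointwise limit of a sequence of rational open sets. There are only
continuum many such sequences, and \<open>X\<close> has as many points, so \<open>Z\<close> can be chosen by diagonalisation to avoid
them all.\<close>

lemma non_gamma_subset_of_double:
  fixes h :: "real \<Rightarrow> real"
  assumes X: "X \<subseteq> {0..1}" and h: "inj h" "range h \<subseteq> X"
  obtains Y where "Y \<subseteq> double X" "\<not> gamma_set Y"
proof -
  obtain T :: "real \<Rightarrow> nat \<Rightarrow> (rat \<times> rat) list \<times> (rat \<times> rat) list" where T: "surj T"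
    using surj_real_sequences_of_countable by blast
  define g where "g x = T (inv h x)" for x
  define Z where "Z = {x \<in> X. \<not> (\<forall>\<^sub>F n in sequentially. x \<in> rat_open (fst (g x n)))}"
  define Y where "Y = Z \<union> (\<lambda>x. x + 2) ` (X - Z)"
  define N where "N c = rat_open (fst c) \<inter> {..<3/2} \<union> (\<lambda>y. y - 2) -` rat_open (snd c) \<inter> {3/2<..}"
    for c
  define dis where "dis c \<longleftrightarrow> rat_open (fst c) \<inter> rat_open (snd c) = {}" for c
  have Z: "Z \<subseteq> X" by (auto simp: Z_def)
  have N1: "x \<in> N c \<longleftrightarrow> x \<in> rat_open (fst c)" if "x \<in> X" for x c
    using that X by (force simp: N_def)
  have N2: "x + 2 \<in> N c \<longleftrightarrow> x \<in> rat_open (snd c)" if "x \<in> X" for x c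
    using that X by (force simp: N_def)
  have opN: "open (N c)" for c
    unfolding N_def by (intro open_Un open_Int open_vimage open_rat_open continuous_intros open_lessThan open_greaterThan)
  \<comment> \<open>The point of \<open>X\<close> that is assigned to the sequence \<open>f\<close> refutes it.\<close>
  have diag: False if d: "\<And>n. dis (f n)" and ev: "\<And>y. y \<in> Y \<Longrightarrow> \<forall>\<^sub>F n in sequentially. y \<in> N (f n)" for f
  proof -
    obtain r where r: "T r = f" using T by (metis surjD)
    define x where "x = h r"
    have x: "x \<in> X" "g x = f" using h r by (auto simp: x_def g_def)
    show False
    proof (cases "x \<in> Z")
      case True
      then have "\<forall>\<^sub>F n in sequentially. x \<in> N (f n)" by (intro ev) (simp add: Y_def)
      then show False using True x N1[OF x(1)] by (simp add: Z_def)
    next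
      case False
      then have "\<forall>\<^sub>F n in sequentially. x + 2 \<in> N (f n)" using x by (intro ev) (simp add: Y_def)
      moreover have "\<forall>\<^sub>F n in sequentially. x \<in> rat_open (fst (f n))" using False x by (simp add: Z_def)
      ultimately have "\<forall>\<^sub>F n in sequentially. False"
        by eventually_elim (use d N2[OF x(1)] in \<open>auto simp: dis_def\<close>)
      then show False by simp
    qed
  qed
  define \<V> where "\<V> = {Y \<inter> N c | c. dis c}"
  have "\<V> \<in> open_omega_covers Y"
  proof -
    have "openin (top_of_set Y) V" if "V \<in> \<V>" for V
      using that opN by (auto simp: \<V>_def openin_open)
    moreover have "Y \<notin> \<V>"
    proof
      assume "Y \<in> \<V>"
      then obtain c where "dis c" "Y = Y \<inter> N c" by (auto simp: \<V>_def)
      then show False by (intro diag[of "\<lambda>_. c"]) auto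
    qed
    moreover have "\<exists>V\<in>\<V>. A \<subseteq> V" if A: "finite A" "A \<subseteq> Y" for A
    proof -
      define A1 where "A1 = A \<inter> Z"
      define A2 where "A2 = (\<lambda>x. x + 2) -` A \<inter> (X - Z)"
      have fin: "finite A1" "finite A2"
        using A(1) by (auto simp: A1_def A2_def intro!: finite_Int finite_vimageI injI)
      have "A1 \<inter> A2 = {}" by (auto simp: A1_def A2_def)
      then obtain U1 U2 where U: "open U1" "open U2" "A1 \<subseteq> U1" "A2 \<subseteq> U2" "U1 \<inter> U2 = {}"
        using separation_normal[of A1 A2] fin finite_imp_closed by metis
      obtain l1 l2 where l: "A1 \<subseteq> rat_open l1" "rat_open l1 \<subseteq> U1" "A2 \<subseteq> rat_open l2" "rat_open l2 \<subseteq> U2"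
        using rat_open_between[OF fin(1) U(1,3)] rat_open_between[OF fin(2) U(2,4)] by blast
      have "dis (l1, l2)" using l U(5) by (auto simp: dis_def)
      moreover have "A \<subseteq> Y \<inter> N (l1, l2)"
      proof
        fix y assume y: "y \<in> A"
        then consider "y \<in> Z" | x where "x \<in> X - Z" "y = x + 2" using A(2) by (auto simp: Y_def)
        then have "y \<in> N (l1, l2)"
        proof cases
          case 1
          then show ?thesis using y l(1) N1[of y "(l1, l2)"] Z by (auto simp: A1_def)
        next
          case 2
          then show ?thesis using y l(3) N2[of x "(l1, l2)"] by (auto simp: A2_def)
        qed
        then show "y \<in> Y \<inter> N (l1, l2)" using y A(2) by blast
      qed
      ultimately show ?thesis unfolding \<V>_def by blast
    qed
    ultimately show ?thesis by (simp add: open_omega_covers_def)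
  qed
  have "\<not> gamma_set Y"
  proof
    assume "gamma_set Y"
    then have "\<exists>U. (\<forall>n::nat. U n \<in> \<V>) \<and> range U \<in> open_gamma_covers Y"
      using \<open>\<V> \<in> open_omega_covers Y\<close> unfolding gamma_set_def S1_def by (elim allE[of _ "\<lambda>_. \<V>"]) simp
    then obtain U :: "nat \<Rightarrow> real set" where U: "\<And>n. U n \<in> \<V>" "range U \<in> open_gamma_covers Y"
      by blast
    then have "infinite (range U)" by (simp add: open_gamma_covers_def)
    then obtain e :: "nat \<Rightarrow> real set" where e: "inj e" "range e \<subseteq> range U"
      using infinite_countable_subset by blast
    have "\<exists>c. dis c \<and> e k = Y \<inter> N c" for k
    proof -
      have "e k \<in> \<V>" using e(2) U(1) by (metis imageE range_subsetD)
      then show ?thesis by (auto simp: \<V>_def)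
    qed
    then obtain f where f: "\<And>k. dis (f k)" "\<And>k. e k = Y \<inter> N (f k)" by metis
    have "\<forall>\<^sub>F k in sequentially. y \<in> N (f k)" if "y \<in> Y" for y
    proof -
      have "finite {V \<in> range U. y \<notin> V}" using U(2) that by (simp add: open_gamma_covers_def)
      then have "finite (e -` {V \<in> range U. y \<notin> V})" using e(1) by (rule finite_vimageI)
      moreover have "{k. y \<notin> N (f k)} \<subseteq> e -` {V \<in> range U. y \<notin> V}" using e(2) f(2) by auto
      ultimately have "finite {k. \<not> y \<in> N (f k)}" by (rule finite_subset[rotated])
      then show ?thesis by (simp add: eventually_cofinite[symmetric] cofinite_eq_sequentially)
    qed
    then show False using diag f(1) by blast
  qed
  moreover have "Y \<subseteq> double X" using Z by (auto simp: Y_def double_def)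
  ultimately show ?thesis using that by blast
qed

theorem mainTheorem1:
  assumes "Continuum_Hypothesis"
  shows "\<exists>X::real set. gamma_set X \<and> sigma_set X \<and> \<not> hereditary_gamma_set X"
proof -
  obtain X and h :: "real \<Rightarrow> real" where X: "X \<subseteq> {0..1}" and h: "inj h" "range h \<subseteq> X"
    and sel: "eventually_selective X" and sigma: "sigma_set X"
    using CH_selective_sigma[OF assms] by blast
  obtain Y where "Y \<subseteq> double X" "\<not> gamma_set Y"
    using non_gamma_subset_of_double[OF X h] by blast
  then have "\<not> hereditary_gamma_set (double X)" by (auto simp: hereditary_gamma_set_def)
  moreover have "gamma_set (double X)"
    by (intro eventually_selective_imp_gamma_set eventually_selective_double sel)
  moreover have "sigma_set (double X)" by (rule sigma_set_double[OF X sigma])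
  ultimately show ?thesis by blast
qed

end
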